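(* Let $p\ge1$ and let $\alpha_1,\ldots,\alpha_p\ge2$ be integers. Let $\nu$ be the ribbon with $p$ columns in which, for $1\le j\le p$, the $j$th column from the left has $\alpha_{p+1-j}-1$ boxes, and for $1\le j\le p-1$ the topmost box of column $j$ lies in the same row as the bottommost box of column $j+1$. Let $\boldsymbol{\gamma}$ be the filling of $\nu$ in which the bottommost box of every column has entry $2$ and every other box has entry $1$. Then $$\zeta^\star(\alpha_1,\ldots,\alpha_p)=\zeta_\nu(\boldsymbol{\gamma}).$$
   Context: $\zeta^\star(\alpha_1,\ldots,\alpha_p)=\sum_{0<m_1\le\cdots\le m_p}\prod_i m_i^{-\alpha_i}$. A ribbon is a connected skew Young diagram containing no $2\times2$ block of boxes. For a skew diagram $\nu$ with box set $D(\nu)$ and a filling $\boldsymbol{\gamma}=(\gamma_{ij})$ of it by positive integers, $\zeta_\nu(\boldsymbol{\gamma})=\sum_{(m_{ij})}\prod_{(i,j)\in D(\nu)}m_{ij}^{-\gamma_{ij}}$, the sum running over semi-standard fillings $(m_{ij})$ of $D(\nu)$ by positive integers (rows weakly increasing left to right, columns strictly increasing top to bottom); rows are numbered from top to bottom and columns from left to right. *)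

theory Defs
  imports "HOL-Analysis.Infinite_Sum" "HOL-Library.FuncSet"
begin

text \<open>Indices are 1-based. Index families are extensional functions (\<open>\<rightarrow>\<^sub>E\<close>), so that each
  tuple or filling is counted exactly once.\<close>

definition star_indices :: "nat \<Rightarrow> (nat \<Rightarrow> nat) set" where
  "star_indices p =
     {m \<in> {1..p} \<rightarrow>\<^sub>E {1..}. \<forall>i\<in>{1..p}. \<forall>j\<in>{1..p}. i \<le> j \<longrightarrow> m i \<le> m j}"

definition star_term :: "nat \<Rightarrow> (nat \<Rightarrow> nat) \<Rightarrow> (nat \<Rightarrow> nat) \<Rightarrow> real" where
  "star_term p \<alpha> m = (\<Prod>i = 1..p. 1 / real (m i) ^ \<alpha> i)"

definition zeta_star :: "nat \<Rightarrow> (nat \<Rightarrow> nat) \<Rightarrow> real" where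
  "zeta_star p \<alpha> = (\<Sum>\<^sub>\<infinity>m\<in>star_indices p. star_term p \<alpha> m)"

text \<open>A partition is given by its parts \<open>\<lambda> 1 \<ge> \<lambda> 2 \<ge> \<dots>\<close>, finitely many of them nonzero;
  the value at 0 is irrelevant. A box is a pair (row, column).\<close>

definition is_partition :: "(nat \<Rightarrow> nat) \<Rightarrow> bool" where
  "is_partition l \<longleftrightarrow> (\<forall>i\<ge>1. l (Suc i) \<le> l i) \<and> finite {i. 1 \<le> i \<and> l i \<noteq> 0}"

definition young_diagram :: "(nat \<Rightarrow> nat) \<Rightarrow> (nat \<times> nat) set" where
  "young_diagram l = {(i, j). 1 \<le> i \<and> 1 \<le> j \<and> j \<le> l i}"

definition skew_diagram :: "(nat \<times> nat) set \<Rightarrow> bool" where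
  "skew_diagram D \<longleftrightarrow>
     (\<exists>l m. is_partition l \<and> is_partition m \<and> young_diagram m \<subseteq> young_diagram l \<and>
            D = young_diagram l - young_diagram m)"

definition adjacent_boxes :: "((nat \<times> nat) \<times> (nat \<times> nat)) set" where
  "adjacent_boxes = {((i, j), (i', j')).
     (i = i' \<and> (j' = Suc j \<or> j = Suc j')) \<or> (j = j' \<and> (i' = Suc i \<or> i = Suc i'))}"

definition connected_boxes :: "(nat \<times> nat) set \<Rightarrow> bool" where
  "connected_boxes D \<longleftrightarrow> (\<forall>x\<in>D. \<forall>y\<in>D. (x, y) \<in> (adjacent_boxes \<inter> D \<times> D)\<^sup>*)"

definition ribbon :: "(nat \<times> nat) set \<Rightarrow> bool" where
  "ribbon D \<longleftrightarrow> skew_diagram D \<and> connected_boxes D \<and>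
     \<not> (\<exists>i j. {(i, j), (i, Suc j), (Suc i, j), (Suc i, Suc j)} \<subseteq> D)"

definition column :: "(nat \<times> nat) set \<Rightarrow> nat \<Rightarrow> nat set" where
  "column D j = {i. (i, j) \<in> D}"

definition semistandard_fillings :: "(nat \<times> nat) set \<Rightarrow> (nat \<times> nat \<Rightarrow> nat) set" where
  "semistandard_fillings D =
     {m \<in> D \<rightarrow>\<^sub>E {1..}.
        (\<forall>i j j'. (i, j) \<in> D \<and> (i, j') \<in> D \<and> j < j' \<longrightarrow> m (i, j) \<le> m (i, j')) \<and>
        (\<forall>i i' j. (i, j) \<in> D \<and> (i', j) \<in> D \<and> i < i' \<longrightarrow> m (i, j) < m (i', j))}"

definition schur_term ::
  "(nat \<times> nat) set \<Rightarrow> (nat \<times> nat \<Rightarrow> nat) \<Rightarrow> (nat \<times> nat \<Rightarrow> nat) \<Rightarrow> real" where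
  "schur_term D \<gamma> m = (\<Prod>b\<in>D. 1 / real (m b) ^ \<gamma> b)"

definition schur_zeta :: "(nat \<times> nat) set \<Rightarrow> (nat \<times> nat \<Rightarrow> nat) \<Rightarrow> real" where
  "schur_zeta D \<gamma> = (\<Sum>\<^sub>\<infinity>m\<in>semistandard_fillings D. schur_term D \<gamma> m)"

text \<open>\<open>D\<close> is the ribbon (unique up to translation) whose \<open>p\<close> columns have heights
  \<open>h 1, \<dots>, h p\<close> from left to right, consecutive columns being glued along a row: the topmost box of
  each column is in the row of the bottommost box of the next one. Row numbers grow downwards, so
  \<open>Min\<close> is topmost and \<open>Max\<close> bottommost. The position of \<open>D\<close> in the plane is left
  arbitrary: its leftmost column is number \<open>c + 1\<close>.\<close>

definition ribbon_with_columns ::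
  "(nat \<times> nat) set \<Rightarrow> nat \<Rightarrow> (nat \<Rightarrow> nat) \<Rightarrow> bool" where
  "ribbon_with_columns D p h \<longleftrightarrow> ribbon D \<and>
     (\<exists>c. snd ` D = {c + 1..c + p} \<and>
          (\<forall>j\<in>{1..p}. card (column D (c + j)) = h j) \<and>
          (\<forall>j\<in>{1..<p}. Min (column D (c + j)) = Max (column D (c + j + 1))))"

lemma ribbon_with_columns_exists:
  assumes p: "1 \<le> p" and h: "\<forall>j\<in>{1..p}. 1 \<le> h j"
  shows "\<exists>D. ribbon_with_columns D p h"
proof -
  define b where "b j = 1 + (\<Sum>k = j..p. h k - 1)" for j
  have b_step: "b j = b (Suc j) + (h j - 1)" if "1 \<le> j" "j \<le> p" for j
    using that unfolding b_def by (simp add: sum.atLeast_Suc_atMost)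
  have b_Suc: "b (Suc j) \<le> b j" for j
    unfolding b_def by (intro add_left_mono sum_mono2) auto
  have b_anti: "b k \<le> b j" if "j \<le> k" for j k
    using that by (rule lift_Suc_antimono_le[of b, OF b_Suc])
  have b_pos: "1 \<le> b j" for j by (simp add: b_def)
  define l where "l i = card {j \<in> {1..p}. i \<le> b j}" for i
  define m where "m i = card {j \<in> {1..p}. i < b (Suc j)}" for i
  define D where "D = {(i, j). 1 \<le> j \<and> j \<le> p \<and> b (Suc j) \<le> i \<and> i \<le> b j}"
  have down: "j \<le> card {j \<in> {1..p}. P j} \<longleftrightarrow> j \<le> p \<and> P j"
    if P: "\<And>j k. j \<le> k \<Longrightarrow> P k \<Longrightarrow> P j" and j: "1 \<le> j" for P j
  proof
    assume "j \<le> p \<and> P j"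
    then have "{1..j} \<subseteq> {j \<in> {1..p}. P j}" using P by auto
    then show "j \<le> card {j \<in> {1..p}. P j}"
      using card_mono[of "{j \<in> {1..p}. P j}" "{1..j}"] by simp
  next
    assume le: "j \<le> card {j \<in> {1..p}. P j}"
    show "j \<le> p \<and> P j"
    proof (rule ccontr)
      assume n: "\<not> (j \<le> p \<and> P j)"
      have "{j \<in> {1..p}. P j} \<subseteq> {1..<j}"
      proof
        fix k assume k: "k \<in> {j \<in> {1..p}. P j}"
        show "k \<in> {1..<j}"
          using n P[of j k] k by (cases "j \<le> k") auto
      qed
      then have "card {j \<in> {1..p}. P j} \<le> j - 1"
        using card_mono[of "{1..<j}"] by fastforce
      then show False using le j by simp
    qed
  qed
  have l_iff: "j \<le> l i \<longleftrightarrow> j \<le> p \<and> i \<le> b j" if "1 \<le> j" for i j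
    proof -
    have "i \<le> b j" if "j \<le> k" "i \<le> b k" for j k
      using b_anti[OF that(1)] that(2) by linarith
    then show ?thesis unfolding l_def by (rule down) (use that in auto)
  qed
  have m_iff: "j \<le> m i \<longleftrightarrow> j \<le> p \<and> i < b (Suc j)" if "1 \<le> j" for i j
    proof -
    have "i < b (Suc j)" if "j \<le> k" "i < b (Suc k)" for j k
      using b_anti[of "Suc j" "Suc k"] that by linarith
    then show ?thesis unfolding m_def by (rule down) (use that in auto)
  qed
  have fin: "{i. 1 \<le> i \<and> f i \<noteq> 0} \<subseteq> {..b 1}"
    if "\<And>i. f i \<le> l i" for f :: "nat \<Rightarrow> nat"
  proof
    fix i assume "i \<in> {i. 1 \<le> i \<and> f i \<noteq> 0}"
    then have "1 \<le> l i" using that[of i] by auto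
    then show "i \<in> {..b 1}" using l_iff[of 1 i] by simp
  qed
  have ml: "m i \<le> l i" for i
  proof -
    have "i \<le> b j" if "i < b (Suc j)" for j
      using that b_Suc[of j] by linarith
    then show ?thesis
      unfolding m_def l_def by (intro card_mono) auto
  qed
  have part: "is_partition l" "is_partition m"
    unfolding is_partition_def
    using finite_subset[OF fin[of l]] finite_subset[OF fin[of m]] ml
    by (auto simp: l_def m_def intro!: card_mono)
  have Deq: "D = young_diagram l - young_diagram m"
  proof (intro set_eqI, clarify)
    fix i j
    show "(i, j) \<in> D \<longleftrightarrow> (i, j) \<in> young_diagram l - young_diagram m"
      using l_iff[of j i] m_iff[of j i] b_pos[of "Suc j"]
      by (auto simp: D_def young_diagram_def)
  qed
  have sub: "young_diagram m \<subseteq> young_diagram l"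
    using order_trans[OF _ ml] by (auto simp: young_diagram_def)
  have skew: "skew_diagram D"
    unfolding skew_diagram_def using part Deq sub by blast
  define R where "R = adjacent_boxes \<inter> D \<times> D"
  have "sym R" unfolding R_def adjacent_boxes_def sym_def by auto
  then have symR: "(y, x) \<in> R\<^sup>*" if "(x, y) \<in> R\<^sup>*" for x y
    using that sym_rtrancl symD by metis
  have col: "((b (Suc j) + n, j), (b (Suc j), j)) \<in> R\<^sup>*"
    if "1 \<le> j" "j \<le> p" "b (Suc j) + n \<le> b j" for j n
    using that(3)
  proof (induction n)
    case (Suc n)
    have "((b (Suc j) + Suc n, j), (b (Suc j) + n, j)) \<in> R"
      using that(1,2) Suc.prems by (auto simp: R_def adjacent_boxes_def D_def)
    moreover have "((b (Suc j) + n, j), (b (Suc j), j)) \<in> R\<^sup>*"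
      using Suc by simp
    ultimately show ?case by (rule converse_rtrancl_into_rtrancl)
  qed simp
  have root: "((i, Suc j), (b 1, 1)) \<in> R\<^sup>*"
    if "(i, Suc j) \<in> D" for i j
    using that
  proof (induction j arbitrary: i)
    case 0
    have c: "((x, 1), (b 2, 1)) \<in> R\<^sup>*" if "(x, 1) \<in> D" for x
      using that col[of 1 "x - b 2"] by (auto simp: D_def numeral_2_eq_2)
    have "(b 1, 1) \<in> D" using p b_Suc by (auto simp: D_def)
    then have "((b 2, 1), (b 1, 1)) \<in> R\<^sup>*"
      using c symR by blast
    then show ?case using c 0 by (metis One_nat_def rtrancl_trans)
  next
    case (Suc j)
    let ?k = "Suc (Suc j)"
    have kp: "?k \<le> p" using Suc.prems by (simp add: D_def)
    have c: "((x, ?k), (b (Suc ?k), ?k)) \<in> R\<^sup>*" if "(x, ?k) \<in> D" for x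
      using that col[of ?k "x - b (Suc ?k)"] by (auto simp: D_def)
    have bk: "(b ?k, ?k) \<in> D" using kp b_Suc by (auto simp: D_def)
    have bj: "(b ?k, Suc j) \<in> D" using kp b_Suc by (auto simp: D_def)
    have "((i, ?k), (b ?k, ?k)) \<in> R\<^sup>*"
      using c[OF Suc.prems] c[OF bk] symR rtrancl_trans by metis
    moreover have "((b ?k, ?k), (b ?k, Suc j)) \<in> R"
      using bk bj by (auto simp: R_def adjacent_boxes_def)
    ultimately show ?case using Suc.IH[OF bj]
      by (meson converse_rtrancl_into_rtrancl rtrancl_trans)
  qed
  have root': "(x, (b 1, 1)) \<in> R\<^sup>*" if "x \<in> D" for x
    using that root[of "fst x" "snd x - 1"] by (cases x) (auto simp: D_def)
  have conn: "connected_boxes D"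
    unfolding connected_boxes_def R_def[symmetric]
    using root' symR rtrancl_trans by metis
  have rib: "ribbon D"
    unfolding ribbon_def using skew conn by (auto simp: D_def)
  have column_eq: "column D j = {b (Suc j)..b j}" if "1 \<le> j" "j \<le> p" for j
    using that by (auto simp: column_def D_def)
  have "snd ` D = {0 + 1..0 + p}"
  proof
    show "{0 + 1..0 + p} \<subseteq> snd ` D"
    proof
      fix j assume "j \<in> {0 + 1..0 + p}"
      then have "(b j, j) \<in> D" using b_Suc by (auto simp: D_def)
      then show "j \<in> snd ` D" by force
    qed
  qed (auto simp: D_def)
  moreover have "\<forall>j\<in>{1..p}. card (column D (0 + j)) = h j"
    using h b_step by (auto simp: column_eq)
  moreover have "\<forall>j\<in>{1..<p}. Min (column D (0 + j)) = Max (column D (0 + j + 1))"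
  proof
    fix j assume j: "j \<in> {1..<p}"
    have "Min {b (Suc j)..b j} = b (Suc j)"
      using b_Suc[of j] by (intro Min_eqI) auto
    moreover have "Max {b (Suc (Suc j))..b (Suc j)} = b (Suc j)"
      using b_Suc[of "Suc j"] by (intro Max_eqI) auto
    ultimately show "Min (column D (0 + j)) = Max (column D (0 + j + 1))"
      using j by (simp add: column_eq)
  qed
  ultimately show ?thesis
    unfolding ribbon_with_columns_def using rib by blast
qed

end

theory Submission
  imports "HOL-Analysis.Infinite_Set_Sum" Defs
begin

text \<open>The proof uses connected sums, a method of Seki and Yamamoto. The connector is
  \<open>C(m, n) = m! n! / (m + n)!\<close>. It satisfies \<open>C(m, b) / b = (C(m, b - 1) - C(m, b)) / m\<close>, so that
  \<open>C(m, n) / m\<close> is the sum of \<open>C(m, b) / b\<close> over all \<open>b > n\<close>. Read from left to right, this trades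
  a factor \<open>1 / m\<close> for a new variable \<open>b > n\<close> with weight \<open>1 / b\<close>, that is, for a new box below the
  box with entry \<open>n\<close>.

  Let \<open>F\<^sub>k(M)\<close> be the star sum for \<open>\<alpha>\<^sub>1, \<dots>, \<alpha>\<^sub>k\<close> restricted to \<open>m\<^sub>k \<le> M\<close>, and let \<open>G\<^sub>k(N)\<close> be the sum
  over the fillings of the \<open>k\<close> rightmost columns of the ribbon whose bottom left entry is at least
  \<open>N\<close>. By induction on \<open>k\<close>, for all \<open>M \<ge> 1\<close>,
  \<open>F\<^sub>k(M) / M\<close> is the sum over \<open>N \<ge> 1\<close> of \<open>G\<^sub>k(N) C(M, N) / N\<close>
  (\<open>dual_pair_star_ribbon\<close>). For \<open>k = 0\<close> this is the telescoping sum. In the step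
  (\<open>dual_pair_step\<close>), all but one of the factors \<open>1 / m\<close> with \<open>m = m\<^bsub>k+1\<^esub>\<close> turn into the boxes
  of the new column, whose top entry is at most the bottom entry of the next column, and
  the remaining factor, summed over \<open>m \<le> M\<close>, gives the bottom box its exponent \<open>2\<close>.

  The numbers \<open>M C(M, N) / N\<close> with \<open>N \<ge> 1\<close> have sum \<open>1\<close> and concentrate at \<open>N = 1\<close> as \<open>M\<close> tends to
  infinity. Hence \<open>F\<^sub>p(M)\<close>, which tends to the star value, tends to \<open>G\<^sub>p(1)\<close>, which is the ribbon
  value (\<open>dual_pair_limit\<close>). At \<open>M = 1\<close> the identity also shows \<open>G\<^sub>p(1) \<le> 2\<close>, so both series converge.

  All sums are taken as integrals over counting measures with values in the extended nonnegative
  reals, where the order of summation can be changed freely; real sums return only at the end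
  (\<open>summable_if_nn_integral_eq\<close>). The iterated sums arise because the boxes of the ribbon, read from
  the bottom left to the top right, form a list in which only neighbours constrain each other
  (\<open>semistandard_fillings_eq_chain_fillings\<close>, \<open>nn_integral_chain_fillings\<close>).\<close>

section \<open>Sums of extended nonnegative reals\<close>

lemma nn_integral_count_space_swap:
  fixes f :: "'a \<Rightarrow> 'b \<Rightarrow> ennreal"
  assumes "\<And>x y. x \<in> A \<and> y \<in> B x \<longleftrightarrow> y \<in> C \<and> x \<in> D y"
  shows "(\<integral>\<^sup>+x. \<integral>\<^sup>+y. f x y \<partial>count_space (B x) \<partial>count_space A) =
         (\<integral>\<^sup>+y. \<integral>\<^sup>+x. f x y \<partial>count_space (D y) \<partial>count_space C)"
proof -
  let ?g = "\<lambda>(x, y). f x y * indicator {(x, y). x \<in> A \<and> y \<in> B x} (x, y)"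
  have "(\<integral>\<^sup>+x. \<integral>\<^sup>+y. f x y \<partial>count_space (B x) \<partial>count_space A) =
        (\<integral>\<^sup>+x. \<integral>\<^sup>+y. ?g (x, y) \<partial>count_space UNIV \<partial>count_space UNIV)"
    by (auto simp: nn_integral_count_space_indicator[of A]
          nn_integral_count_space_indicator[of "B _"]
        intro!: nn_integral_cong split: split_indicator)
  also have "\<dots> = (\<integral>\<^sup>+y. \<integral>\<^sup>+x. ?g (x, y) \<partial>count_space UNIV \<partial>count_space UNIV)"
    by (simp only: nn_integral_fst_count_space nn_integral_snd_count_space)
  also have "\<dots> = (\<integral>\<^sup>+y. \<integral>\<^sup>+x. f x y \<partial>count_space (D y) \<partial>count_space C)"
    using assms
    by (auto simp: nn_integral_count_space_indicator[of C]
          nn_integral_count_space_indicator[of "D _"]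
        intro!: nn_integral_cong split: split_indicator)
  finally show ?thesis .
qed

lemma nn_integral_count_space_Sigma:
  fixes f :: "'a \<Rightarrow> 'b \<Rightarrow> ennreal"
  shows "(\<integral>\<^sup>+x. \<integral>\<^sup>+y. f x y \<partial>count_space (B x) \<partial>count_space A) =
         (\<integral>\<^sup>+z. f (fst z) (snd z) \<partial>count_space (Sigma A B))"
proof -
  let ?g = "\<lambda>(x, y). f x y * indicator (Sigma A B) (x, y)"
  have "(\<integral>\<^sup>+x. \<integral>\<^sup>+y. f x y \<partial>count_space (B x) \<partial>count_space A) =
        (\<integral>\<^sup>+x. \<integral>\<^sup>+y. ?g (x, y) \<partial>count_space UNIV \<partial>count_space UNIV)"
    by (auto simp: nn_integral_count_space_indicator[of A]
          nn_integral_count_space_indicator[of "B _"]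
        intro!: nn_integral_cong split: split_indicator)
  also have "\<dots> = (\<integral>\<^sup>+z. ?g z \<partial>count_space UNIV)"
    by (simp only: nn_integral_fst_count_space)
  also have "\<dots> = (\<integral>\<^sup>+z. f (fst z) (snd z) \<partial>count_space (Sigma A B))"
    by (auto simp: nn_integral_count_space_indicator[of "Sigma A B"]
        intro!: nn_integral_cong split: split_indicator)
  finally show ?thesis .
qed

lemma ennreal_mult_left_assoc:
  assumes "0 \<le> a" "0 \<le> b"
  shows "ennreal a * (ennreal b * x) = ennreal (a * b) * x"
  by (simp only: ennreal_mult[OF assms] mult.assoc)

lemma SUP_nn_integral_atLeastAtMost:
  fixes f :: "nat \<Rightarrow> ennreal"
  shows "(SUP M. \<integral>\<^sup>+x. f x \<partial>count_space {1..Suc M}) = (\<integral>\<^sup>+x. f x \<partial>count_space {1..})"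
proof -
  have "(\<integral>\<^sup>+x. f x \<partial>count_space {1..}) =
      (\<integral>\<^sup>+x. (SUP M. f x * indicator {1..Suc M} x) \<partial>count_space UNIV)"
  proof (subst nn_integral_count_space_indicator, simp, rule nn_integral_cong)
    fix x
    show "f x * indicator {1..} x = (SUP M. f x * indicator {1..Suc M} x)"
      by (intro antisym SUP_upper2[of x] SUP_least) (auto split: split_indicator)
  qed
  also have "\<dots> = (SUP M. \<integral>\<^sup>+x. f x * indicator {1..Suc M} x \<partial>count_space UNIV)"
    by (intro nn_integral_monotone_convergence_SUP)
       (auto simp: incseq_def le_fun_def split: split_indicator)
  finally show ?thesis
    by (simp add: nn_integral_count_space_indicator)
qed

lemma summable_if_nn_integral_eq:
  fixes f :: "'a \<Rightarrow> real"
  assumes nonneg: "\<And>x. x \<in> A \<Longrightarrow> 0 \<le> f x"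
    and I: "(\<integral>\<^sup>+x. ennreal (f x) \<partial>count_space A) = c" and c: "c < \<infinity>"
  shows "f summable_on A" and "infsum f A = enn2real c"
proof -
  have *: "Infinite_Set_Sum.abs_summable_on f A"
    unfolding Infinite_Set_Sum.abs_summable_on_def
    using nonneg I c by (intro integrableI_bounded) (auto simp: cong: nn_integral_cong_simp)
  then show "f summable_on A"
    by (simp add: abs_summable_summable flip: abs_summable_equivalent)
  from * show "infsum f A = enn2real c"
    using I nonneg by (simp add: nn_integral_conv_infsetsum infsetsum_infsum[symmetric] infsetsum_nonneg
      flip: I)
qed

section \<open>The connector\<close>

text \<open>The reciprocal of the binomial coefficient \<open>m + n\<close> over \<open>n\<close>.\<close>

definition connector :: "nat \<Rightarrow> nat \<Rightarrow> real" where
  "connector m n = fact m * fact n / fact (m + n)"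

lemma connector_commute: "connector m n = connector n m"
  by (simp add: connector_def add.commute mult.commute)

lemma connector_0_right [simp]: "connector m 0 = 1"
  by (simp add: connector_def)

lemma connector_nonneg: "0 \<le> connector m n"
  by (simp add: connector_def)

text \<open>This identity makes every sum over the connector telescope: a factor \<open>1 / m\<close> can be traded for a
  new summation variable with weight \<open>1 / b\<close>.\<close>

lemma connector_transport:
  assumes "1 \<le> m"
  shows "connector m (Suc n) / real (Suc n) = (connector m n - connector m (Suc n)) / real m"
  using assms by (simp add: connector_def field_simps del: of_nat_Suc) (simp add: algebra_simps)

lemma connector_tendsto_0:
  assumes "1 \<le> m"
  shows "connector m \<longlonglongrightarrow> 0"
proof (rule tendsto_sandwich[OF _ _ tendsto_const])
  show "\<forall>\<^sub>F n in sequentially. connector m n \<le> 1 / real (Suc n)"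
  proof (intro always_eventually allI)
    fix n
    \<comment> \<open>The connector decreases in its first argument, and at \<open>m = 1\<close> it is explicit.\<close>
    have "connector m n \<le> connector 1 n"
      using assms
    proof (induction m rule: dec_induct)
      case (step k)
      have "connector (Suc k) n = connector k n * (real (Suc k) / real (Suc (k + n)))"
        by (simp add: connector_def mult_ac)
      also have "\<dots> \<le> connector k n * 1"
        by (intro mult_left_mono connector_nonneg) simp
      finally show ?case using step.IH by linarith
    qed simp
    also have "connector 1 n = 1 / real (Suc n)"
      by (simp add: connector_def)
    finally show "connector m n \<le> 1 / real (Suc n)" .
  qed
  show "(\<lambda>n. 1 / real (Suc n)) \<longlonglongrightarrow> 0"
    using LIMSEQ_inverse_real_of_nat by (simp add: inverse_eq_divide)
qed (simp add: connector_nonneg)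

lemma connector_sum:
  assumes "1 \<le> m"
  shows "(\<Sum>b = 1..n. connector m b / real b) = (1 - connector m n) / real m"
  using assms
proof (induction n)
  case (Suc n)
  then show ?case using connector_transport[of m n]
    by (simp add: diff_divide_distrib del: of_nat_Suc)
qed simp

lemma connector_tail:
  assumes "1 \<le> m"
  shows "(\<integral>\<^sup>+b. ennreal (connector m b / real b) \<partial>count_space {n<..}) =
         ennreal (connector m n / real m)"
proof -
  have bij: "bij_betw (\<lambda>k. Suc (n + k)) UNIV {n<..}"
    by (rule bij_betwI[where g = "\<lambda>b. b - Suc n"]) auto
  have "(\<lambda>k. connector m (n + k)) \<longlonglongrightarrow> 0"
    using LIMSEQ_ignore_initial_segment[OF connector_tendsto_0[OF assms], of n]
    by (simp add: add.commute)
  from sums_divide[OF telescope_sums'[OF this], of "real m"]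
  have "(\<lambda>k. connector m (Suc (n + k)) / real (Suc (n + k))) sums (connector m n / real m)"
    using assms by (simp add: connector_transport del: of_nat_Suc)
  then have "(\<Sum>k. ennreal (connector m (Suc (n + k)) / real (Suc (n + k)))) =
      ennreal (connector m n / real m)"
    by (rule suminf_ennreal_eq[rotated]) (simp add: connector_nonneg)
  then show ?thesis
    by (simp only: nn_integral_bij_count_space[OF bij, symmetric] nn_integral_count_space_nat)
qed

section \<open>Dual pairs of truncated sums\<close>

text \<open>The invariant of the induction on the number of columns. For \<open>F\<close> read a star sum whose largest
  variable is at most \<open>M\<close>, and for \<open>G\<close> a ribbon sum whose bottom left entry is at least \<open>N\<close>.
  Multiplied by \<open>M\<close>, the weights on the right form a probability distribution in \<open>N\<close>
  (\<open>dual_pair_one\<close>).\<close>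

definition dual_pair :: "(nat \<Rightarrow> ennreal) \<Rightarrow> (nat \<Rightarrow> ennreal) \<Rightarrow> bool" where
  "dual_pair F G \<longleftrightarrow> (\<forall>M\<ge>1. ennreal (1 / real M) * F M =
     (\<integral>\<^sup>+N. ennreal (connector M N / real N) * G N \<partial>count_space {1..}))"

lemma dual_pair_one: "dual_pair (\<lambda>_. 1) (\<lambda>_. 1)"
proof -
  have "{1..} = {0::nat<..}" by auto
  then show ?thesis
    using connector_tail[of _ 0] by (simp add: dual_pair_def)
qed

text \<open>The sum over a chain \<open>x\<^sub>1 < \<dots> < x\<^sub>i < n\<close> of \<open>G x\<^sub>1 / (x\<^sub>1 \<cdots> x\<^sub>i)\<close>: the entries above the bottom
  entry \<open>n\<close> of a column with \<open>i + 1\<close> boxes, with \<open>G\<close> applied to the top entry, which is \<open>n\<close> itself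
  when the column has a single box.\<close>

primrec column_sum :: "(nat \<Rightarrow> ennreal) \<Rightarrow> nat \<Rightarrow> nat \<Rightarrow> ennreal" where
  "column_sum G 0 n = G n"
| "column_sum G (Suc i) n =
     (\<integral>\<^sup>+x. ennreal (1 / real x) * column_sum G i x \<partial>count_space {1..<n})"

text \<open>Each further box of the column absorbs one more factor \<open>1 / m\<close>: after exchanging the two
  summations, the sum over the new bottom entry \<open>n > x\<close> is a tail of the connector.\<close>

lemma connector_column_sum:
  assumes FG: "dual_pair F G" and m: "1 \<le> m"
  shows "(\<integral>\<^sup>+n. ennreal (connector m n / real n) * column_sum G i n \<partial>count_space {1..}) =
         ennreal (1 / real m ^ Suc i) * F m"
proof (induction i)
  case 0
  show ?case using FG m by (simp add: dual_pair_def)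
next
  case (Suc i)
  have "(\<integral>\<^sup>+n. ennreal (connector m n / real n) * column_sum G (Suc i) n \<partial>count_space {1..}) =
        (\<integral>\<^sup>+n. \<integral>\<^sup>+x. ennreal (connector m n / real n) * (ennreal (1 / real x) * column_sum G i x)
           \<partial>count_space {1..<n} \<partial>count_space {1..})"
    by (simp add: nn_integral_cmult)
  also have "\<dots> = (\<integral>\<^sup>+x. \<integral>\<^sup>+n. ennreal (connector m n / real n) * (ennreal (1 / real x) * column_sum G i x)
           \<partial>count_space {x<..} \<partial>count_space {1..})"
    by (rule nn_integral_count_space_swap) auto
  also have "\<dots> = (\<integral>\<^sup>+x. ennreal (1 / real m) * (ennreal (connector m x / real x) * column_sum G i x)
           \<partial>count_space {1..})"
    by (intro nn_integral_cong, subst nn_integral_multc, simp, subst connector_tail[OF m])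
       (simp add: connector_nonneg ennreal_mult_left_assoc mult.commute[of "real m"])
  also have "\<dots> = ennreal (1 / real m ^ Suc (Suc i)) * F m"
    by (subst nn_integral_cmult, simp, subst Suc) (simp add: ennreal_mult_left_assoc)
  finally show ?case .
qed

text \<open>Adding one exponent on the star side and one column on the ribbon side. All but one of the
  \<open>i + 2\<close> factors \<open>1 / m\<close> become the \<open>i + 1\<close> boxes of the new column. The last factor and the sum
  over \<open>m \<le> M\<close> telescope to \<open>(1 - connector M n) / n\<close>, where \<open>n\<close> is the bottom entry; this gives
  the bottom box its second factor \<open>1 / n\<close>. Telescoping in the other argument,
  \<open>(1 - connector M n) / M\<close> is the sum of \<open>connector M N / N\<close> over \<open>N \<le> n\<close>, which is the
  required bound on the bottom entry.\<close>

lemma dual_pair_step: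
  assumes FG: "dual_pair F G"
  shows "dual_pair (\<lambda>M. \<integral>\<^sup>+m. ennreal (1 / real m ^ (i + 2)) * F m \<partial>count_space {1..M})
                   (\<lambda>N. \<integral>\<^sup>+n. ennreal (1 / real n ^ 2) * column_sum G i n \<partial>count_space {N..})"
  unfolding dual_pair_def
proof (intro allI impI)
  fix M :: nat assume M: "1 \<le> M"
  let ?c = "column_sum G i"
  have fin: "(\<integral>\<^sup>+k. ennreal (f k) * C \<partial>count_space {1..n}) = ennreal (sum f {1..n}) * C"
    if "\<And>k. 0 \<le> f k" for f :: "nat \<Rightarrow> real" and C n
    by (subst nn_integral_multc, simp, subst nn_integral_count_space_finite)
       (simp_all add: sum_ennreal[OF that])
  have "(\<integral>\<^sup>+m. ennreal (1 / real m ^ (i + 2)) * F m \<partial>count_space {1..M}) =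
        (\<integral>\<^sup>+m. \<integral>\<^sup>+n. ennreal (connector n m / real m) * (ennreal (1 / real n) * ?c n)
           \<partial>count_space {1..} \<partial>count_space {1..M})"
  proof (rule nn_integral_cong)
    fix m assume "m \<in> space (count_space {1..M})"
    then have m: "1 \<le> m" by simp
    have "ennreal (1 / real m ^ (i + 2)) * F m =
        ennreal (1 / real m) * (ennreal (1 / real m ^ Suc i) * F m)"
      by (simp add: ennreal_mult_left_assoc)
    also have "\<dots> = (\<integral>\<^sup>+n. ennreal (connector n m / real m) * (ennreal (1 / real n) * ?c n)
        \<partial>count_space {1..})"
      unfolding connector_column_sum[OF FG m, symmetric]
      by (subst nn_integral_cmult[symmetric])
         (simp_all add: connector_nonneg connector_commute[of m] ennreal_mult_left_assoc
           mult.commute[of "real m"])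
    finally show "ennreal (1 / real m ^ (i + 2)) * F m =
      (\<integral>\<^sup>+n. ennreal (connector n m / real m) * (ennreal (1 / real n) * ?c n)
        \<partial>count_space {1..})" .
  qed
  also have "\<dots> = (\<integral>\<^sup>+n. \<integral>\<^sup>+m. ennreal (connector n m / real m) * (ennreal (1 / real n) * ?c n)
      \<partial>count_space {1..M} \<partial>count_space {1..})"
    by (rule nn_integral_count_space_swap) auto
  also have "\<dots> = (\<integral>\<^sup>+n. ennreal ((1 - connector M n) / real n) * (ennreal (1 / real n) * ?c n)
      \<partial>count_space {1..})"
  proof (rule nn_integral_cong)
    fix n :: nat assume "n \<in> space (count_space {1..})"
    then have n: "1 \<le> n" by simp
    show "(\<integral>\<^sup>+m. ennreal (connector n m / real m) * (ennreal (1 / real n) * ?c n)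
        \<partial>count_space {1..M}) = ennreal ((1 - connector M n) / real n) * (ennreal (1 / real n) * ?c n)"
      unfolding connector_commute[of M n] connector_sum[OF n, of M, symmetric]
      by (rule fin) (simp add: connector_nonneg)
  qed
  finally have "ennreal (1 / real M) *
        (\<integral>\<^sup>+m. ennreal (1 / real m ^ (i + 2)) * F m \<partial>count_space {1..M}) =
      ennreal (1 / real M) *
        (\<integral>\<^sup>+n. ennreal ((1 - connector M n) / real n) * (ennreal (1 / real n) * ?c n)
          \<partial>count_space {1..})"
    by simp
  also have "\<dots> = (\<integral>\<^sup>+n. \<integral>\<^sup>+N. ennreal (connector M N / real N) * (ennreal (1 / real n ^ 2) * ?c n)
      \<partial>count_space {1..n} \<partial>count_space {1..})"
    unfolding nn_integral_cmult[symmetric, OF borel_measurable_count_space]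
  proof (rule nn_integral_cong)
    fix n :: nat
    have nonneg: "0 \<le> 1 - connector M n"
      using connector_sum[OF M, of n] M
        sum_nonneg[of "{1..n}" "\<lambda>b. connector M b / real b"]
      by (simp add: connector_nonneg zero_le_divide_iff)
    have "(\<integral>\<^sup>+N. ennreal (connector M N / real N) * (ennreal (1 / real n ^ 2) * ?c n)
          \<partial>count_space {1..n}) =
        ennreal ((1 - connector M n) / real M) * (ennreal (1 / real n ^ 2) * ?c n)"
      unfolding connector_sum[OF M, of n, symmetric]
      by (rule fin) (simp add: connector_nonneg)
    moreover have "ennreal (1 / real M) *
        (ennreal ((1 - connector M n) / real n) * (ennreal (1 / real n) * ?c n)) =
        ennreal ((1 - connector M n) / real M) * (ennreal (1 / real n ^ 2) * ?c n)"
      using nonneg by (simp add: ennreal_mult_left_assoc power2_eq_square)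
    ultimately show "ennreal (1 / real M) *
          (ennreal ((1 - connector M n) / real n) * (ennreal (1 / real n) * ?c n)) =
        (\<integral>\<^sup>+N. ennreal (connector M N / real N) * (ennreal (1 / real n ^ 2) * ?c n)
          \<partial>count_space {1..n})"
      by simp
  qed
  also have "\<dots> = (\<integral>\<^sup>+N. \<integral>\<^sup>+n. ennreal (connector M N / real N) * (ennreal (1 / real n ^ 2) * ?c n)
      \<partial>count_space {N..} \<partial>count_space {1..})"
    by (rule nn_integral_count_space_swap) auto
  finally show "ennreal (1 / real M) *
        (\<integral>\<^sup>+m. ennreal (1 / real m ^ (i + 2)) * F m \<partial>count_space {1..M}) =
    (\<integral>\<^sup>+N. ennreal (connector M N / real N) *
       (\<integral>\<^sup>+n. ennreal (1 / real n ^ 2) * ?c n \<partial>count_space {N..}) \<partial>count_space {1..})"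
    by (simp add: nn_integral_cmult)
qed

text \<open>As \<open>M\<close> grows, the weights of the dual pair concentrate at \<open>N = 1\<close>, where \<open>M\<close>
  times the weight is \<open>M / (M + 1)\<close>; since \<open>G\<close> is largest at \<open>1\<close>, this squeezes \<open>F M\<close> to \<open>G 1\<close>. The same
  estimate at \<open>M = 1\<close> bounds \<open>G 1\<close>, and with it all values of \<open>F\<close>.\<close>

lemma dual_pair_limit:
  assumes FG: "dual_pair F G" and F1: "F 1 = 1"
    and G: "\<And>N. 1 \<le> N \<Longrightarrow> G N \<le> G 1"
  shows "(SUP M. F (Suc M)) = G 1" and "G 1 \<le> 2"
proof -
  have scale: "ennreal (real M) * (ennreal (1 / real M) * x) = x" if "1 \<le> M" for M x
    using that by (simp add: ennreal_mult_left_assoc)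
  have upper: "F M \<le> G 1" if M: "1 \<le> M" for M
  proof -
    have "ennreal (1 / real M) * F M \<le>
        (\<integral>\<^sup>+N. ennreal (connector M N / real N) * G 1 \<partial>count_space {1..})"
      using FG M G unfolding dual_pair_def by (auto intro!: nn_integral_mono mult_left_mono)
    also have "\<dots> = ennreal (1 / real M) * G 1"
      using dual_pair_one M by (simp add: dual_pair_def nn_integral_multc)
    finally have "ennreal (real M) * (ennreal (1 / real M) * F M) \<le>
        ennreal (real M) * (ennreal (1 / real M) * G 1)"
      by (rule mult_left_mono) simp
    then show ?thesis by (simp only: scale[OF M])
  qed
  have lower: "ennreal (real M / (real M + 1)) * G 1 \<le> F M" if M: "1 \<le> M" for M
  proof -
    have "ennreal (1 / (real M + 1)) * G 1 = ennreal (connector M 1 / real 1) * G 1"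
      by (simp add: connector_def add.commute)
    also have "\<dots> \<le> ennreal (1 / real M) * F M"
      using FG M nn_integral_ge_point[of 1 "{1..}" "\<lambda>N. ennreal (connector M N / real N) * G N"]
      by (simp add: dual_pair_def)
    finally have "ennreal (real M) * (ennreal (1 / (real M + 1)) * G 1) \<le>
        ennreal (real M) * (ennreal (1 / real M) * F M)"
      by (rule mult_left_mono) simp
    then show ?thesis by (simp only: scale[OF M]) (simp add: ennreal_mult_left_assoc)
  qed
  have "ennreal 2 * ennreal (1 / 2) = 1"
    by (subst ennreal_mult[symmetric]) auto
  then have "G 1 = ennreal 2 * (ennreal (1 / 2) * G 1)"
    by (simp only: mult.assoc[symmetric] mult_1)
  also have "\<dots> \<le> ennreal 2 * 1"
    using lower[of 1] F1 by (intro mult_left_mono) auto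
  finally show "G 1 \<le> 2" by simp
  have "(\<lambda>M. ennreal (real M / (real M + 1)) * G 1) \<longlonglongrightarrow> ennreal 1 * G 1"
  proof (intro tendsto_mult_ennreal tendsto_const tendsto_ennrealI)
    show "(\<lambda>M. real M / (real M + 1)) \<longlonglongrightarrow> 1"
      using LIMSEQ_n_over_Suc_n by (simp add: add.commute)
  qed auto
  from LIMSEQ_Suc[OF this]
  have lim: "(\<lambda>M. ennreal (real (Suc M) / (real (Suc M) + 1)) * G 1) \<longlonglongrightarrow> G 1" by simp
  show "(SUP M. F (Suc M)) = G 1"
  proof (rule antisym)
    have "ennreal (real (Suc M) / (real (Suc M) + 1)) * G 1 \<le> (SUP M. F (Suc M))" for M
      using lower[of "Suc M"] SUP_upper[of M UNIV "\<lambda>M. F (Suc M)"] by (auto intro: order_trans)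
    then show "G 1 \<le> (SUP M. F (Suc M))"
      by (intro LIMSEQ_le_const2[OF lim]) auto
    show "(SUP M. F (Suc M)) \<le> G 1"
      by (intro SUP_least upper) simp
  qed
qed

lemma dual_pair_cong:
  assumes "\<And>M. 1 \<le> M \<Longrightarrow> F M = F' M" "\<And>N. 1 \<le> N \<Longrightarrow> G N = G' N"
  shows "dual_pair F G \<longleftrightarrow> dual_pair F' G'"
  unfolding dual_pair_def using assms
  by (intro all_cong1 imp_cong arg_cong2[where f = "(=)"]) (auto intro!: nn_integral_cong)

section \<open>Fillings of a list of boxes\<close>

text \<open>Both index sets of the theorem consist of fillings of a list of boxes, constrained by a relation
  between the entries of neighbouring boxes only. The head of the list is the box that was added
  last; in \<open>R b a y x\<close> the box \<open>b\<close> with entry \<open>y\<close> stands directly before the box \<open>a\<close> with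
  entry \<open>x\<close>.\<close>

definition chain_fillings ::
  "('a \<Rightarrow> 'a \<Rightarrow> nat \<Rightarrow> nat \<Rightarrow> bool) \<Rightarrow> 'a list \<Rightarrow> ('a \<Rightarrow> nat) set" where
  "chain_fillings R l = {m \<in> set l \<rightarrow>\<^sub>E {1..}. successively (\<lambda>b a. R b a (m b) (m a)) l}"

text \<open>The total weight of the fillings whose head entry is \<open>y\<close>, computed box by box. As the
  empty list has no head, no filling of it has head entry \<open>y\<close>.\<close>

primrec head_weight ::
  "('a \<Rightarrow> 'a \<Rightarrow> nat \<Rightarrow> nat \<Rightarrow> bool) \<Rightarrow> ('a \<Rightarrow> nat \<Rightarrow> ennreal) \<Rightarrow> 'a list \<Rightarrow> nat \<Rightarrow> ennreal" where
  "head_weight R w [] y = 0"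
| "head_weight R w (b # l) y = w b y *
     (if l = [] then 1
      else (\<integral>\<^sup>+x. head_weight R w l x \<partial>count_space {x. 1 \<le> x \<and> R b (hd l) y x}))"

text \<open>The total weight of the fillings whose head entry lies in \<open>S\<close>. The empty list has one filling, of
  weight \<open>1\<close>, which is counted for every \<open>S\<close>; this makes the empty star sum and the empty ribbon the
  start of the induction.\<close>

definition head_sum ::
  "('a \<Rightarrow> 'a \<Rightarrow> nat \<Rightarrow> nat \<Rightarrow> bool) \<Rightarrow> ('a \<Rightarrow> nat \<Rightarrow> ennreal) \<Rightarrow> 'a list \<Rightarrow> nat set \<Rightarrow> ennreal" where
  "head_sum R w l S = (if l = [] then 1 else (\<integral>\<^sup>+x. head_weight R w l x \<partial>count_space S))"

lemma head_weight_Cons: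
  "head_weight R w (b # l) y = w b y * head_sum R w l {x. 1 \<le> x \<and> R b (hd l) y x}"
  by (simp add: head_sum_def)

lemma bij_betw_chain_fillings_Cons:
  assumes "b \<notin> set l"
  shows "bij_betw (\<lambda>z. (fst z)(b := snd z))
    (SIGMA m:chain_fillings R l. {y. 1 \<le> y \<and> (l = [] \<or> R b (hd l) y (m (hd l)))})
    (chain_fillings R (b # l))"
proof (rule bij_betwI[where g = "\<lambda>m. (restrict m (set l), m b)"])
  have succ: "successively (\<lambda>b a. R b a (m b) (m a)) l \<longleftrightarrow>
      successively (\<lambda>b a. R b a (m' b) (m' a)) l" if "\<And>a. a \<in> set l \<Longrightarrow> m a = m' a" for m m'
    using that by (intro successively_cong) auto
  show "(\<lambda>z. (fst z)(b := snd z)) \<in>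
      (SIGMA m:chain_fillings R l. {y. 1 \<le> y \<and> (l = [] \<or> R b (hd l) y (m (hd l)))}) \<rightarrow>
      chain_fillings R (b # l)"
  proof
    fix z
    assume "z \<in> (SIGMA m:chain_fillings R l. {y. 1 \<le> y \<and> (l = [] \<or> R b (hd l) y (m (hd l)))})"
    then obtain m y where z: "z = (m, y)" and m: "m \<in> set l \<rightarrow>\<^sub>E {1..}" and y: "1 \<le> y"
      and s: "successively (\<lambda>b a. R b a (m b) (m a)) l"
      and R: "l = [] \<or> R b (hd l) y (m (hd l))"
      by (auto simp: chain_fillings_def)
    have "m(b := y) \<in> set (b # l) \<rightarrow>\<^sub>E {1..}"
      using m y by (auto simp: PiE_iff extensional_def)
    moreover have "successively (\<lambda>c a. R c a ((m(b := y)) c) ((m(b := y)) a)) l"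
      using s assms by (subst succ[where m' = m]) auto
    moreover have "l = [] \<or> hd l \<noteq> b"
      using assms hd_in_set by metis
    ultimately show "(fst z)(b := snd z) \<in> chain_fillings R (b # l)"
      using R unfolding z chain_fillings_def by (auto simp: successively_Cons)
  qed
  show "(\<lambda>m. (restrict m (set l), m b)) \<in> chain_fillings R (b # l) \<rightarrow>
      (SIGMA m:chain_fillings R l. {y. 1 \<le> y \<and> (l = [] \<or> R b (hd l) y (m (hd l)))})"
  proof
    fix m assume m: "m \<in> chain_fillings R (b # l)"
    have "successively (\<lambda>b a. R b a (restrict m (set l) b) (restrict m (set l) a)) l"
      using m by (subst succ[where m' = m]) (auto simp: chain_fillings_def successively_Cons)
    then show "(restrict m (set l), m b) \<in>
        (SIGMA m:chain_fillings R l. {y. 1 \<le> y \<and> (l = [] \<or> R b (hd l) y (m (hd l)))})"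
      using m by (cases "l = []") (auto simp: chain_fillings_def successively_Cons)
  qed
  fix z assume "z \<in> (SIGMA m:chain_fillings R l. {y. 1 \<le> y \<and> (l = [] \<or> R b (hd l) y (m (hd l)))})"
  then show "(restrict ((fst z)(b := snd z)) (set l), ((fst z)(b := snd z)) b) = z"
    using assms by (cases z) (auto simp: chain_fillings_def PiE_def extensional_def restrict_def fun_eq_iff)
next
  fix m assume "m \<in> chain_fillings R (b # l)"
  then show "(fst (restrict m (set l), m b))(b := snd (restrict m (set l), m b)) = m"
    by (auto simp: chain_fillings_def PiE_def extensional_def restrict_def fun_eq_iff)
qed

text \<open>The arbitrary function \<open>f\<close> of the head entry carries the induction: summing over the entry of a
  new head turns \<open>f\<close> into another function of the old head entry.\<close>

lemma nn_integral_chain_fillings: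
  assumes "distinct l" "l \<noteq> []"
  shows "(\<integral>\<^sup>+m. f (m (hd l)) * (\<Prod>a\<in>set l. w a (m a)) \<partial>count_space (chain_fillings R l)) =
         (\<integral>\<^sup>+y. f y * head_weight R w l y \<partial>count_space {1..})"
  using assms(2,1)
proof (induction l arbitrary: f rule: list_nonempty_induct)
  case (single b)
  have "chain_fillings R [] = {\<lambda>_. undefined}"
    by (auto simp: chain_fillings_def)
  then show ?case
    using nn_integral_bij_count_space[OF bij_betw_chain_fillings_Cons[of b "[]" R],
        of "\<lambda>m. f (m b) * w b (m b)"]
    by (simp add: nn_integral_count_space_finite atLeast_def
        flip: nn_integral_count_space_Sigma[where f = "\<lambda>m y. f y * w b y"])
next
  case (cons b l)
  let ?Y = "\<lambda>x. {y. 1 \<le> y \<and> R b (hd l) y x}"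
  have b: "b \<notin> set l" "hd l \<noteq> b" using cons by auto
  have prod: "(\<Prod>a\<in>set l. w a (if a = b then y else m a)) = (\<Prod>a\<in>set l. w a (m a))" for m y
    using b by (intro prod.cong) auto
  have "(\<integral>\<^sup>+m. f (m (hd (b # l))) * (\<Prod>a\<in>set (b # l). w a (m a)) \<partial>count_space (chain_fillings R (b # l)))
    = (\<integral>\<^sup>+m. \<integral>\<^sup>+y. f y * (w b y * (\<Prod>a\<in>set l. w a (m a)))
        \<partial>count_space (?Y (m (hd l))) \<partial>count_space (chain_fillings R l))"
    unfolding nn_integral_count_space_Sigma
      nn_integral_bij_count_space[OF bij_betw_chain_fillings_Cons[OF b(1)], symmetric]
    using b cons.hyps by (simp add: prod)
  also have "\<dots> = (\<integral>\<^sup>+m. (\<integral>\<^sup>+y. f y * w b y \<partial>count_space (?Y (m (hd l)))) * (\<Prod>a\<in>set l. w a (m a))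
      \<partial>count_space (chain_fillings R l))"
    by (subst nn_integral_multc[symmetric]) (simp_all add: mult.assoc)
  also have "\<dots> = (\<integral>\<^sup>+x. (\<integral>\<^sup>+y. f y * w b y \<partial>count_space (?Y x)) * head_weight R w l x
      \<partial>count_space {1..})"
    using cons by (intro cons.IH) auto
  also have "\<dots> = (\<integral>\<^sup>+x. \<integral>\<^sup>+y. f y * (w b y * head_weight R w l x) \<partial>count_space (?Y x) \<partial>count_space {1..})"
    by (subst nn_integral_multc[symmetric]) (simp_all add: mult.assoc)
  also have "\<dots> = (\<integral>\<^sup>+y. \<integral>\<^sup>+x. f y * (w b y * head_weight R w l x)
      \<partial>count_space {x. 1 \<le> x \<and> R b (hd l) y x} \<partial>count_space {1..})"
    by (rule nn_integral_count_space_swap) auto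
  also have "\<dots> = (\<integral>\<^sup>+y. f y * head_weight R w (b # l) y \<partial>count_space {1..})"
    using cons.hyps by (simp add: nn_integral_cmult)
  finally show ?case .
qed

corollary nn_integral_chain_fillings':
  assumes "distinct l" "l \<noteq> []"
  shows "(\<integral>\<^sup>+m. (\<Prod>a\<in>set l. w a (m a)) \<partial>count_space (chain_fillings R l)) =
         head_sum R w l {1..}"
  using nn_integral_chain_fillings[OF assms, where f = "\<lambda>_. 1"] assms(2) by (simp add: head_sum_def)

lemma sorted_wrt_sorted_list_of_set:
  assumes "finite A"
  shows "sorted_wrt P (sorted_list_of_set A) \<longleftrightarrow> (\<forall>i\<in>A. \<forall>j\<in>A. i < j \<longrightarrow> P i j)"
proof -
  have "sorted_wrt P xs \<longleftrightarrow> (\<forall>i\<in>set xs. \<forall>j\<in>set xs. i < j \<longrightarrow> P i j)"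
    if "sorted_wrt (<) xs" for xs :: "'a list"
    using that by (induction xs) (auto dest: less_asym)
  from this[of "sorted_list_of_set A"] assms show ?thesis by simp
qed

section \<open>Star sums\<close>

lemma star_indices_eq_chain_fillings:
  "star_indices p = chain_fillings (\<lambda>_ _ y x. x \<le> y) (rev [1..<Suc p])"
proof -
  have "successively (\<lambda>b a. m a \<le> m b) (rev [1..<Suc p]) \<longleftrightarrow>
      (\<forall>i\<in>{1..p}. \<forall>j\<in>{1..p}. i \<le> j \<longrightarrow> m i \<le> m j)" for m :: "nat \<Rightarrow> nat"
  proof -
    have "successively (\<lambda>b a. m a \<le> m b) (rev [1..<Suc p]) \<longleftrightarrow>
        sorted_wrt (\<lambda>i j. m i \<le> m j) (sorted_list_of_set {1..<Suc p})"
      unfolding successively_rev sorted_list_of_set_range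
      by (rule successively_conv_sorted_wrt) (auto intro: transpI)
    also have "\<dots> \<longleftrightarrow> (\<forall>i\<in>{1..p}. \<forall>j\<in>{1..p}. i \<le> j \<longrightarrow> m i \<le> m j)"
      by (subst sorted_wrt_sorted_list_of_set) (auto simp: le_less atLeastLessThanSuc_atLeastAtMost)
    finally show ?thesis .
  qed
  then show ?thesis
    by (simp add: star_indices_def chain_fillings_def atLeastLessThanSuc_atLeastAtMost del: upt_Suc)
qed

lemma head_sum_star_Suc:
  "head_sum (\<lambda>_ _ y x. x \<le> y) w (rev [1..<Suc (Suc k)]) S =
   (\<integral>\<^sup>+m. w (Suc k) m * head_sum (\<lambda>_ _ y x. x \<le> y) w (rev [1..<Suc k]) {1..m} \<partial>count_space S)"
proof -
  have "{x. 1 \<le> x \<and> x \<le> m} = {1..m}" for m :: nat by auto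
  then have hw: "head_weight (\<lambda>_ _ y x. x \<le> y) w (Suc k # rev [1..<Suc k]) m =
      w (Suc k) m * head_sum (\<lambda>_ _ y x. x \<le> y) w (rev [1..<Suc k]) {1..m}" for m
    unfolding head_weight_Cons by simp
  have "rev [1..<Suc (Suc k)] = Suc k # rev [1..<Suc k]" by simp
  then have "head_sum (\<lambda>_ _ y x. x \<le> y) w (rev [1..<Suc (Suc k)]) S =
      (\<integral>\<^sup>+m. head_weight (\<lambda>_ _ y x. x \<le> y) w (Suc k # rev [1..<Suc k]) m \<partial>count_space S)"
    unfolding head_sum_def by (simp only: list.distinct if_False)
  then show ?thesis by (simp only: hw)
qed

section \<open>Ribbon sums\<close>

text \<open>The list runs through the ribbon from the bottom left box to the top right one, so the next box is
  either the one above or, from the top of a column, the one to the right.\<close>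

definition ribbon_rel :: "nat \<times> nat \<Rightarrow> nat \<times> nat \<Rightarrow> nat \<Rightarrow> nat \<Rightarrow> bool" where
  "ribbon_rel b a y x \<longleftrightarrow> (if snd b = snd a then x < y else y \<le> x)"

text \<open>The box to the right of the top of the column must have an entry at least the top entry, so the
  rest of the ribbon contributes its \<open>head_sum\<close> over \<open>{N..}\<close>, taken at the top entry.\<close>

lemma head_weight_column:
  assumes "\<forall>a\<in>set cs. snd a = snd b \<and> (\<forall>y. w a y = ennreal (1 / real y))"
    and "l = [] \<or> snd (hd l) \<noteq> snd b" and "1 \<le> y"
  shows "head_weight ribbon_rel w (b # cs @ l) y =
    w b y * column_sum (\<lambda>N. head_sum ribbon_rel w l {N..}) (length cs) y"
  using assms
proof (induction cs arbitrary: b y)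
  case Nil
  have "{x. 1 \<le> x \<and> ribbon_rel b (hd l) y x} = {y..}" if "l \<noteq> []"
    using Nil that by (auto simp: ribbon_rel_def)
  then have "head_sum ribbon_rel w l {x. 1 \<le> x \<and> ribbon_rel b (hd l) y x} =
      head_sum ribbon_rel w l {y..}"
    by (simp add: head_sum_def)
  then show ?case
    unfolding append_Nil head_weight_Cons by simp
next
  case (Cons a cs)
  have "{x. 1 \<le> x \<and> ribbon_rel b (hd (a # cs @ l)) y x} = {1..<y}"
    using Cons.prems by (auto simp: ribbon_rel_def)
  then have "head_weight ribbon_rel w (b # (a # cs) @ l) y =
      w b y * (\<integral>\<^sup>+x. head_weight ribbon_rel w (a # cs @ l) x \<partial>count_space {1..<y})"
    unfolding head_weight_Cons[of _ _ b] by (simp add: head_sum_def del: head_weight.simps)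
  also have "(\<integral>\<^sup>+x. head_weight ribbon_rel w (a # cs @ l) x \<partial>count_space {1..<y}) =
      (\<integral>\<^sup>+x. w a x * column_sum (\<lambda>N. head_sum ribbon_rel w l {N..}) (length cs) x
        \<partial>count_space {1..<y})"
    using Cons.prems by (intro nn_integral_cong Cons.IH) auto
  finally show ?case using Cons.prems by simp
qed

text \<open>From bottom to top, that is by decreasing row number.\<close>

definition column_boxes :: "(nat \<times> nat) set \<Rightarrow> nat \<Rightarrow> (nat \<times> nat) list" where
  "column_boxes D j = map (\<lambda>i. (i, j)) (rev (sorted_list_of_set (column D j)))"

text \<open>The boxes of the columns \<open>c - k + 1, \<dots>, c\<close>; here \<open>c\<close> is the number of the rightmost column.\<close>

primrec right_columns :: "(nat \<times> nat) set \<Rightarrow> nat \<Rightarrow> nat \<Rightarrow> (nat \<times> nat) list" where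
  "right_columns D c 0 = []"
| "right_columns D c (Suc k) = column_boxes D (c - k) @ right_columns D c k"

lemma set_column_boxes:
  "finite (column D j) \<Longrightarrow> set (column_boxes D j) = {b \<in> D. snd b = j}"
  by (auto simp: column_boxes_def column_def)

lemma hd_last_column_boxes:
  assumes "finite (column D j)" "column D j \<noteq> {}"
  shows "column_boxes D j \<noteq> []"
    and "hd (column_boxes D j) = (Max (column D j), j)"
    and "last (column_boxes D j) = (Min (column D j), j)"
proof -
  have ne: "sorted_list_of_set (column D j) \<noteq> []"
    using assms by simp
  then show "column_boxes D j \<noteq> []"
    by (simp add: column_boxes_def)
  have "last (sorted_list_of_set (column D j)) = Max (column D j)"
  proof (intro Max_eqI[symmetric])
    show "i \<le> last (sorted_list_of_set (column D j))" if "i \<in> column D j" for i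
    proof -
      have "i \<in> set (sorted_list_of_set (column D j))" using assms that by simp
      then show ?thesis
        using ne by (auto simp: in_set_conv_nth last_conv_nth intro!: sorted_nth_mono)
    qed
    show "last (sorted_list_of_set (column D j)) \<in> column D j"
      using last_in_set[OF ne] assms(1) by simp
  qed (use assms(1) in simp)
  then show "hd (column_boxes D j) = (Max (column D j), j)"
    using ne by (simp add: column_boxes_def hd_map hd_rev)
  have "hd (sorted_list_of_set (column D j)) = Min (column D j)"
    using assms by (simp add: sorted_list_of_set_nonempty)
  then show "last (column_boxes D j) = (Min (column D j), j)"
    using ne by (simp add: column_boxes_def last_map last_rev)
qed

lemma successively_column_boxes:
  assumes "finite (column D j)"
  shows "successively (\<lambda>b a. ribbon_rel b a (m b) (m a)) (column_boxes D j) \<longleftrightarrow>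
    (\<forall>i\<in>column D j. \<forall>i'\<in>column D j. i < i' \<longrightarrow> m (i, j) < m (i', j))"
proof -
  have "successively (\<lambda>b a. ribbon_rel b a (m b) (m a)) (column_boxes D j) \<longleftrightarrow>
      sorted_wrt (\<lambda>i i'. m (i, j) < m (i', j)) (sorted_list_of_set (column D j))"
    unfolding column_boxes_def successively_map successively_rev ribbon_rel_def
    by (simp, rule successively_conv_sorted_wrt) (auto intro: transpI)
  then show ?thesis
    using assms by (simp add: sorted_wrt_sorted_list_of_set)
qed

text \<open>The relation between neighbours amounts to strict increase down each column, by transitivity, and
  to one inequality for each pair of consecutive columns. The four claims are proved together, since
  extending the list by a column involves its current head.\<close>

lemma right_columns_structure:
  assumes col: "\<And>j. j \<in> {Suc c..c + p} \<Longrightarrow> finite (column D j) \<and> column D j \<noteq> {}"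
    and k: "k \<le> p"
  shows "set (right_columns D (c + p) k) = {b \<in> D. snd b \<in> {Suc (c + p - k)..c + p}}"
    and "distinct (right_columns D (c + p) k)"
    and "successively (\<lambda>b a. ribbon_rel b a (m b) (m a)) (right_columns D (c + p) k) \<longleftrightarrow>
      (\<forall>j\<in>{Suc (c + p - k)..c + p}. \<forall>i\<in>column D j. \<forall>i'\<in>column D j.
         i < i' \<longrightarrow> m (i, j) < m (i', j)) \<and>
      (\<forall>j\<in>{Suc (c + p - k)..<c + p}.
         m (Min (column D j), j) \<le> m (Max (column D (Suc j)), Suc j))"
    and "0 < k \<Longrightarrow> right_columns D (c + p) k \<noteq> [] \<and>
      hd (right_columns D (c + p) k) = (Max (column D (Suc (c + p - k))), Suc (c + p - k))"
proof -
  have "set (right_columns D (c + p) k) = {b \<in> D. snd b \<in> {Suc (c + p - k)..c + p}} \<and>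
    distinct (right_columns D (c + p) k) \<and>
    (successively (\<lambda>b a. ribbon_rel b a (m b) (m a)) (right_columns D (c + p) k) \<longleftrightarrow>
      (\<forall>j\<in>{Suc (c + p - k)..c + p}. \<forall>i\<in>column D j. \<forall>i'\<in>column D j.
         i < i' \<longrightarrow> m (i, j) < m (i', j)) \<and>
      (\<forall>j\<in>{Suc (c + p - k)..<c + p}.
         m (Min (column D j), j) \<le> m (Max (column D (Suc j)), Suc j))) \<and>
    (0 < k \<longrightarrow> right_columns D (c + p) k \<noteq> [] \<and>
      hd (right_columns D (c + p) k) = (Max (column D (Suc (c + p - k))), Suc (c + p - k)))"
    using k
  proof (induction k)
    case (Suc k)
    define j where "j = c + p - k"
    have eq: "Suc (c + p - Suc k) = j" "j \<le> c + p" "j \<in> {Suc c..c + p}"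
      using Suc.prems by (auto simp: j_def)
    have interval: "{j..c + p} = insert j {Suc j..c + p}"
      using eq by auto
    note IH = Suc.IH[OF Suc_leD[OF Suc.prems], folded j_def]
    have fin: "finite (column D j)" and ne: "column D j \<noteq> {}"
      using col[OF eq(3)] by auto
    note hl = hd_last_column_boxes[OF fin ne]
    have rc: "right_columns D (c + p) (Suc k) = column_boxes D j @ right_columns D (c + p) k"
      by (simp add: j_def)
    have "distinct (column_boxes D j)"
      by (auto simp: column_boxes_def distinct_map inj_on_def)
    then have D: "distinct (right_columns D (c + p) (Suc k))"
      using IH unfolding rc by (auto simp: set_column_boxes[OF fin])
    have S: "set (right_columns D (c + p) (Suc k)) = {b \<in> D. snd b \<in> {j..c + p}}"
      using IH unfolding rc interval by (auto simp: set_column_boxes[OF fin])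
    have H: "hd (right_columns D (c + p) (Suc k)) = (Max (column D j), j)"
      "right_columns D (c + p) (Suc k) \<noteq> []"
      unfolding rc using hl by simp_all
    have "successively (\<lambda>b a. ribbon_rel b a (m b) (m a)) (right_columns D (c + p) (Suc k)) \<longleftrightarrow>
      (\<forall>j\<in>{j..c + p}. \<forall>i\<in>column D j. \<forall>i'\<in>column D j.
         i < i' \<longrightarrow> m (i, j) < m (i', j)) \<and>
      (\<forall>j\<in>{j..<c + p}. m (Min (column D j), j) \<le> m (Max (column D (Suc j)), Suc j))"
    proof (cases "k = 0")
      case True
      then show ?thesis
        unfolding rc using successively_column_boxes[OF fin, of m] by (simp add: j_def)
    next
      case False
      then have interval': "{j..<c + p} = insert j {Suc j..<c + p}"
        using eq by (auto simp: j_def)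
      have "ribbon_rel (last (column_boxes D j)) (hd (right_columns D (c + p) k))
          (m (last (column_boxes D j))) (m (hd (right_columns D (c + p) k))) \<longleftrightarrow>
          m (Min (column D j), j) \<le> m (Max (column D (Suc j)), Suc j)"
        using IH False hl by (simp add: ribbon_rel_def)
      then show ?thesis
        unfolding rc successively_append_iff interval interval'
        using IH False hl successively_column_boxes[OF fin, of m] by auto
    qed
    with D S H show ?case unfolding eq by blast
  qed auto
  then show "set (right_columns D (c + p) k) = {b \<in> D. snd b \<in> {Suc (c + p - k)..c + p}}"
    "distinct (right_columns D (c + p) k)"
    "successively (\<lambda>b a. ribbon_rel b a (m b) (m a)) (right_columns D (c + p) k) \<longleftrightarrow>
      (\<forall>j\<in>{Suc (c + p - k)..c + p}. \<forall>i\<in>column D j. \<forall>i'\<in>column D j.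
         i < i' \<longrightarrow> m (i, j) < m (i', j)) \<and>
      (\<forall>j\<in>{Suc (c + p - k)..<c + p}.
         m (Min (column D j), j) \<le> m (Max (column D (Suc j)), Suc j))"
    "0 < k \<Longrightarrow> right_columns D (c + p) k \<noteq> [] \<and>
      hd (right_columns D (c + p) k) = (Max (column D (Suc (c + p - k))), Suc (c + p - k))"
    by blast+
qed

text \<open>Each column lies weakly above the row of the top box of the column before it. Hence, if two boxes
  share a row, every column between them also has a box in that row, and it is there that
  consecutive columns are glued. So all row inequalities follow from those at the gluing rows.\<close>

lemma glued_columns_rows:
  assumes col: "\<And>j. j \<in> {Suc c..c + p} \<Longrightarrow> finite (column D j) \<and> column D j \<noteq> {}"
    and cols: "snd ` D \<subseteq> {Suc c..c + p}"
    and glue: "\<And>j. j \<in> {Suc c..<c + p} \<Longrightarrow> Min (column D j) = Max (column D (Suc j))"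
  shows "(\<forall>i j j'. (i, j) \<in> D \<and> (i, j') \<in> D \<and> j < j' \<longrightarrow> m (i, j) \<le> (m (i, j') :: nat)) \<longleftrightarrow>
    (\<forall>j\<in>{Suc c..<c + p}. m (Min (column D j), j) \<le> m (Max (column D (Suc j)), Suc j))"
proof
  assume rows: "\<forall>i j j'. (i, j) \<in> D \<and> (i, j') \<in> D \<and> j < j' \<longrightarrow> m (i, j) \<le> m (i, j')"
  show "\<forall>j\<in>{Suc c..<c + p}. m (Min (column D j), j) \<le> m (Max (column D (Suc j)), Suc j)"
  proof
    fix j assume j: "j \<in> {Suc c..<c + p}"
    have "Min (column D j) \<in> column D j" "Max (column D (Suc j)) \<in> column D (Suc j)"
      using col[of j] col[of "Suc j"] j by auto
    then show "m (Min (column D j), j) \<le> m (Max (column D (Suc j)), Suc j)"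
      using rows glue[OF j] by (auto simp: column_def)
  qed
next
  assume corner: "\<forall>j\<in>{Suc c..<c + p}. m (Min (column D j), j) \<le> m (Max (column D (Suc j)), Suc j)"
  have below: "i \<le> Min (column D j)"
    if "Suc c \<le> j" "j + Suc n \<le> c + p" "i \<in> column D (j + Suc n)" for i j n
    using that(2,3)
  proof (induction n arbitrary: i)
    case 0
    then show ?case using that(1) col[of "Suc j"] glue[of j] by auto
  next
    case (Suc n)
    let ?j = "j + Suc n"
    have "i \<le> Min (column D ?j)"
      using Suc.prems that(1) col[of "Suc ?j"] glue[of ?j] by auto
    also have "\<dots> \<le> Min (column D j)"
      using Suc.prems that(1) col[of ?j] by (intro Suc.IH Min_in) auto
    finally show ?case .
  qed
  have next_column: "m (i, j) \<le> m (i, Suc j)" "i \<in> column D (Suc j)"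
    if "Suc c \<le> j" "j + Suc n \<le> c + p" "i \<in> column D j" "i \<in> column D (j + Suc n)" for i j n
  proof -
    have i: "i = Min (column D j)"
      using below[of j n i] col[of j] that by (intro antisym) auto
    moreover have i': "i = Max (column D (Suc j))"
      using i glue[of j] that by auto
    moreover have "m (Min (column D j), j) \<le> m (Max (column D (Suc j)), Suc j)"
      using corner that by auto
    ultimately show "m (i, j) \<le> m (i, Suc j)" by (simp only:)
    show "i \<in> column D (Suc j)"
      unfolding i' using col[of "Suc j"] that by auto
  qed
  have row: "m (i, j) \<le> m (i, j + Suc n)"
    if "Suc c \<le> j" "j + Suc n \<le> c + p" "i \<in> column D j" "i \<in> column D (j + Suc n)" for i j n
    using that
  proof (induction n arbitrary: j)
    case 0
    then show ?case using next_column(1)[of j 0 i] by simp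
  next
    case (Suc n)
    then have "m (i, Suc j) \<le> m (i, Suc j + Suc n)"
      using next_column(2)[of j "Suc n" i] by (intro Suc.IH) auto
    then show ?case
      using next_column(1)[OF Suc.prems] by simp
  qed
  show "\<forall>i j j'. (i, j) \<in> D \<and> (i, j') \<in> D \<and> j < j' \<longrightarrow> m (i, j) \<le> m (i, j')"
  proof (intro allI impI)
    fix i j j' assume ij: "(i, j) \<in> D \<and> (i, j') \<in> D \<and> j < j'"
    then obtain n where "j' = j + Suc n"
      using less_iff_Suc_add by auto
    moreover have "Suc c \<le> j" "j' \<le> c + p"
      using ij cols by force+
    ultimately show "m (i, j) \<le> m (i, j')"
      using row[of j n i] ij by (auto simp: column_def)
  qed
qed

lemma semistandard_fillings_eq_chain_fillings:
  assumes col: "\<And>j. j \<in> {Suc c..c + p} \<Longrightarrow> finite (column D j) \<and> column D j \<noteq> {}"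
    and cols: "snd ` D \<subseteq> {Suc c..c + p}"
    and glue: "\<And>j. j \<in> {Suc c..<c + p} \<Longrightarrow> Min (column D j) = Max (column D (Suc j))"
  shows "set (right_columns D (c + p) p) = D"
    and "semistandard_fillings D = chain_fillings ribbon_rel (right_columns D (c + p) p)"
proof -
  show D: "set (right_columns D (c + p) p) = D"
    using right_columns_structure(1)[where c = c and p = p and k = p, OF col order_refl] cols by auto
  have columns: "(\<forall>i i' j. (i, j) \<in> D \<and> (i', j) \<in> D \<and> i < i' \<longrightarrow> m (i, j) < m (i', j)) \<longleftrightarrow>
      (\<forall>j\<in>{Suc c..c + p}. \<forall>i\<in>column D j. \<forall>i'\<in>column D j. i < i' \<longrightarrow> m (i, j) < m (i', j))"
    for m :: "nat \<times> nat \<Rightarrow> nat"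
    using cols by (fastforce simp: column_def)
  have "successively (\<lambda>b a. ribbon_rel b a (m b) (m a)) (right_columns D (c + p) p) \<longleftrightarrow>
      (\<forall>i j j'. (i, j) \<in> D \<and> (i, j') \<in> D \<and> j < j' \<longrightarrow> m (i, j) \<le> m (i, j')) \<and>
      (\<forall>i i' j. (i, j) \<in> D \<and> (i', j) \<in> D \<and> i < i' \<longrightarrow> m (i, j) < m (i', j))" for m
  proof -
    have "successively (\<lambda>b a. ribbon_rel b a (m b) (m a)) (right_columns D (c + p) p) \<longleftrightarrow>
      (\<forall>j\<in>{Suc c..c + p}. \<forall>i\<in>column D j. \<forall>i'\<in>column D j. i < i' \<longrightarrow> m (i, j) < m (i', j)) \<and>
      (\<forall>j\<in>{Suc c..<c + p}. m (Min (column D j), j) \<le> m (Max (column D (Suc j)), Suc j))"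
      using right_columns_structure(3)[where c = c and p = p and k = p and m = m, OF col order_refl]
      by (simp only: add_diff_cancel_right')
    moreover have "(\<forall>i j j'. (i, j) \<in> D \<and> (i, j') \<in> D \<and> j < j' \<longrightarrow> m (i, j) \<le> m (i, j')) \<longleftrightarrow>
      (\<forall>j\<in>{Suc c..<c + p}. m (Min (column D j), j) \<le> m (Max (column D (Suc j)), Suc j))"
      by (rule glued_columns_rows[OF _ cols]) (use col glue in blast)+
    ultimately show ?thesis
      using columns[of m] by argo
  qed
  then show "semistandard_fillings D = chain_fillings ribbon_rel (right_columns D (c + p) p)"
    by (simp add: semistandard_fillings_def chain_fillings_def D)
qed

lemma column_boxes_split:
  assumes "finite (column D j)" "column D j \<noteq> {}"
  obtains cs where "column_boxes D j = (Max (column D j), j) # cs"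
    "length cs = card (column D j) - 1"
    "\<forall>a\<in>set cs. a \<in> D \<and> snd a = j \<and> fst a \<noteq> Max (column D j)"
proof -
  obtain cs where cs: "column_boxes D j = (Max (column D j), j) # cs"
    using hd_last_column_boxes(1,2)[OF assms] by (cases "column_boxes D j") auto
  have "distinct (column_boxes D j)"
    by (auto simp: column_boxes_def distinct_map inj_on_def)
  then have notin: "(Max (column D j), j) \<notin> set cs"
    unfolding cs by simp
  have "\<forall>a\<in>set cs. a \<in> D \<and> snd a = j \<and> fst a \<noteq> Max (column D j)"
  proof
    fix a assume a: "a \<in> set cs"
    then have "a \<in> D \<and> snd a = j"
      using set_column_boxes[OF assms(1)] unfolding cs by auto
    moreover have "a \<noteq> (Max (column D j), j)"
      using a notin by blast
    ultimately show "a \<in> D \<and> snd a = j \<and> fst a \<noteq> Max (column D j)"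
      by (cases a) auto
  qed
  moreover have "length (column_boxes D j) = card (column D j)"
    by (simp add: column_boxes_def)
  ultimately show thesis using that cs by simp
qed

lemma head_sum_right_columns_Suc:
  assumes fin: "finite (column D j)" and ne: "column D j \<noteq> {}"
    and j: "j = c - k"
    and w: "\<And>i y. i \<in> column D j \<Longrightarrow> w (i, j) y =
       ennreal (1 / real y ^ (if i = Max (column D j) then 2 else 1))"
    and l: "right_columns D c k = [] \<or> snd (hd (right_columns D c k)) \<noteq> j"
    and N: "1 \<le> N"
  shows "head_sum ribbon_rel w (right_columns D c (Suc k)) {N..} =
    (\<integral>\<^sup>+n. ennreal (1 / real n ^ 2) *
       column_sum (\<lambda>N. head_sum ribbon_rel w (right_columns D c k) {N..}) (card (column D j) - 1) n
       \<partial>count_space {N..})"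
proof -
  obtain cs where cs: "column_boxes D j = (Max (column D j), j) # cs"
    "length cs = card (column D j) - 1"
    "\<forall>a\<in>set cs. a \<in> D \<and> snd a = j \<and> fst a \<noteq> Max (column D j)"
    using column_boxes_split[OF fin ne] by blast
  have rc: "right_columns D c (Suc k) = (Max (column D j), j) # cs @ right_columns D c k"
    using cs(1) j by simp
  have "head_weight ribbon_rel w (right_columns D c (Suc k)) n = ennreal (1 / real n ^ 2) *
      column_sum (\<lambda>N. head_sum ribbon_rel w (right_columns D c k) {N..}) (card (column D j) - 1) n"
    if "1 \<le> n" for n
  proof -
    have "\<forall>a\<in>set cs. snd a = snd (Max (column D j), j) \<and> (\<forall>y. w a y = ennreal (1 / real y))"
      using cs(3) w by (auto simp: column_def)
    then show ?thesis
      unfolding rc using l that w[OF Max_in[OF fin ne]]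
      by (subst head_weight_column) (auto simp: cs(2))
  qed
  then show ?thesis
    unfolding head_sum_def using rc N by (auto intro!: nn_integral_cong)
qed

lemma head_sum_atLeast_antimono:
  "head_sum R w l {N..} \<le> head_sum R w l {1..}" if "1 \<le> N" for N :: nat
  using that unfolding head_sum_def
  by (auto simp: nn_integral_count_space_indicator[of "{_..}"]
      intro!: nn_integral_mono split: split_indicator)

section \<open>Duality between star sums and ribbons\<close>

text \<open>The ribbon grows to the left while the star sum grows by larger variables: column \<open>p - k\<close> of the
  ribbon, with \<open>\<alpha> (k + 1) - 1\<close> boxes, is added together with \<open>m\<^bsub>k+1\<^esub>\<close>.\<close>

lemma dual_pair_star_ribbon:
  assumes col: "\<And>j. j \<in> {Suc c..c + p} \<Longrightarrow> finite (column \<nu> j) \<and> column \<nu> j \<noteq> {}"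
    and alpha: "\<And>i. i \<in> {1..p} \<Longrightarrow> 2 \<le> \<alpha> i"
    and card: "\<And>j. j \<in> {1..p} \<Longrightarrow> card (column \<nu> (c + j)) = \<alpha> (p + 1 - j) - 1"
    and weight: "\<And>i j y. (i, j) \<in> \<nu> \<Longrightarrow>
      v (i, j) y = ennreal (1 / real y ^ (if i = Max (column \<nu> j) then 2 else 1))"
    and k: "k \<le> p"
  shows "dual_pair
    (\<lambda>M. head_sum (\<lambda>_ _ y x. x \<le> y) (\<lambda>i y. ennreal (1 / real y ^ \<alpha> i)) (rev [1..<Suc k]) {1..M})
    (\<lambda>N. head_sum ribbon_rel v (right_columns \<nu> (c + p) k) {N..})"
  using k
proof (induction k)
  case 0
  show ?case using dual_pair_one by (simp add: head_sum_def)
next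
  case (Suc k)
  let ?j = "c + p - k" and ?a = "\<alpha> (Suc k)"
  have j: "?j \<in> {Suc c..c + p}" using Suc.prems by auto
  have a: "2 \<le> ?a" using alpha[of "Suc k"] Suc.prems by simp
  have "card (column \<nu> (c + (p - k))) = \<alpha> (p + 1 - (p - k)) - 1"
    using Suc.prems by (intro card) auto
  then have height: "card (column \<nu> ?j) - 1 = ?a - 2"
    using Suc.prems by (simp add: Suc_diff_le)
  have top: "right_columns \<nu> (c + p) k = [] \<or> snd (hd (right_columns \<nu> (c + p) k)) \<noteq> ?j"
    using right_columns_structure(4)[where c = c and p = p and k = k, OF col] Suc.prems
    by (cases "k = 0") auto
  have ribbon: "head_sum ribbon_rel v (right_columns \<nu> (c + p) (Suc k)) {N..} =
      (\<integral>\<^sup>+n. ennreal (1 / real n ^ 2) *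
         column_sum (\<lambda>N. head_sum ribbon_rel v (right_columns \<nu> (c + p) k) {N..}) (?a - 2) n
         \<partial>count_space {N..})" if "1 \<le> N" for N
  proof (subst head_sum_right_columns_Suc[where j = ?j])
    show "v (i, ?j) y = ennreal (1 / real y ^ (if i = Max (column \<nu> ?j) then 2 else 1))"
      if "i \<in> column \<nu> ?j" for i y
      using that by (intro weight) (simp add: column_def)
  qed (use col[OF j] top that in \<open>simp_all add: height[unfolded One_nat_def]\<close>)
  have "?a - 2 + 2 = ?a" using a by simp
  note step = dual_pair_step[OF Suc.IH[OF Suc_leD[OF Suc.prems]], of "?a - 2", unfolded this]
  show ?case
    by (rule iffD2[OF dual_pair_cong step]) (simp_all only: head_sum_star_Suc ribbon)
qed

theorem corollary6p5:
  fixes p :: nat and \<alpha> :: "nat \<Rightarrow> nat"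
    and \<nu> :: "(nat \<times> nat) set" and \<gamma> :: "nat \<times> nat \<Rightarrow> nat"
  assumes "1 \<le> p"
    and "\<forall>i\<in>{1..p}. 2 \<le> \<alpha> i"
    and "ribbon_with_columns \<nu> p (\<lambda>j. \<alpha> (p + 1 - j) - 1)"
    and "\<forall>(i, j)\<in>\<nu>. \<gamma> (i, j) = (if i = Max (column \<nu> j) then 2 else 1)"
  shows "star_term p \<alpha> summable_on star_indices p \<and>
         schur_term \<nu> \<gamma> summable_on semistandard_fillings \<nu> \<and>
         zeta_star p \<alpha> = schur_zeta \<nu> \<gamma>"
proof -
  obtain c where cols: "snd ` \<nu> = {c + 1..c + p}"
    and card: "\<And>j. j \<in> {1..p} \<Longrightarrow> card (column \<nu> (c + j)) = \<alpha> (p + 1 - j) - 1"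
    and glue: "\<And>j. j \<in> {1..<p} \<Longrightarrow> Min (column \<nu> (c + j)) = Max (column \<nu> (c + j + 1))"
    using assms(3) unfolding ribbon_with_columns_def by blast
  have col: "finite (column \<nu> j) \<and> column \<nu> j \<noteq> {}" if "j \<in> {Suc c..c + p}" for j
  proof -
    obtain i where i: "j = c + i" "i \<in> {1..p}"
      using \<open>j \<in> _\<close> by (intro that[of "j - c"]) auto
    moreover have "2 \<le> \<alpha> (p + 1 - i)"
      using i(2) by (intro assms(2)[rule_format]) auto
    ultimately have "0 < card (column \<nu> j)"
      using card[OF i(2)] by simp
    then show ?thesis
      by (simp add: card_gt_0_iff)
  qed
  have cols': "snd ` \<nu> \<subseteq> {Suc c..c + p}" using cols by simp
  have glue': "Min (column \<nu> j) = Max (column \<nu> (Suc j))" if "j \<in> {Suc c..<c + p}" for j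
  proof -
    obtain i where "j = c + i" "i \<in> {1..<p}"
      using \<open>j \<in> _\<close> by (intro that[of "j - c"]) auto
    then show ?thesis using glue[of i] by simp
  qed
  have L: "distinct (right_columns \<nu> (c + p) p)" "right_columns \<nu> (c + p) p \<noteq> []"
    using right_columns_structure(2,4)[where c = c and p = p and k = p, OF col] assms(1) by simp_all
  have fillings: "set (right_columns \<nu> (c + p) p) = \<nu>"
    "semistandard_fillings \<nu> = chain_fillings ribbon_rel (right_columns \<nu> (c + p) p)"
    by (rule semistandard_fillings_eq_chain_fillings[OF _ cols']; use col glue' in blast)+
  define L where "L = right_columns \<nu> (c + p) p"
  define w where "w = (\<lambda>i y. ennreal (1 / real y ^ \<alpha> i))"
  define v where "v = (\<lambda>b y. ennreal (1 / real y ^ \<gamma> b))"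
  define F where "F M = head_sum (\<lambda>_ _ y x. x \<le> y) w (rev [1..<Suc p]) {1..M}" for M
  define G where "G N = head_sum ribbon_rel v L {N..}" for N
  have FG: "dual_pair F G"
    unfolding F_def G_def L_def w_def
    by (rule dual_pair_star_ribbon[OF col]) (use assms(2,4) card in \<open>auto simp: v_def\<close>)
  \<comment> \<open>All variables of the star sum are at most \<open>1\<close>, hence equal to \<open>1\<close>.\<close>
  have "F 1 = 1"
  proof -
    have "head_sum (\<lambda>_ _ y x. x \<le> y) w (rev [1..<Suc k]) {1..1} = 1" for k
    proof (induction k)
      case (Suc k)
      show ?case
        unfolding head_sum_star_Suc using Suc
        by (simp add: w_def nn_integral_count_space_finite del: upt_Suc)
    qed (simp add: head_sum_def)
    then show ?thesis by (simp only: F_def)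
  qed
  note limit = dual_pair_limit[OF FG this head_sum_atLeast_antimono[of _ ribbon_rel v L, folded G_def]]
  have star: "(\<integral>\<^sup>+m. ennreal (star_term p \<alpha> m) \<partial>count_space (star_indices p)) = G 1"
  proof -
    have ne: "rev [1..<Suc p] \<noteq> []" using assms(1) by simp
    have "ennreal (star_term p \<alpha> m) = (\<Prod>i\<in>set (rev [1..<Suc p]). w i (m i))" for m
      by (simp add: star_term_def w_def prod_ennreal atLeastLessThanSuc_atLeastAtMost del: upt_Suc)
    then have "(\<integral>\<^sup>+m. ennreal (star_term p \<alpha> m) \<partial>count_space (star_indices p)) =
        head_sum (\<lambda>_ _ y x. x \<le> y) w (rev [1..<Suc p]) {1..}"
      using ne by (simp only: star_indices_eq_chain_fillings) (rule nn_integral_chain_fillings', simp_all del: upt_Suc)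
    also have "\<dots> = (SUP M. F (Suc M))"
      by (simp only: F_def head_sum_def ne if_False SUP_nn_integral_atLeastAtMost)
    finally show ?thesis by (simp only: limit(1))
  qed
  have schur: "(\<integral>\<^sup>+m. ennreal (schur_term \<nu> \<gamma> m) \<partial>count_space (semistandard_fillings \<nu>)) = G 1"
  proof -
    have "ennreal (schur_term \<nu> \<gamma> m) = (\<Prod>b\<in>set L. v b (m b))" for m
      by (simp add: schur_term_def v_def prod_ennreal L_def fillings(1))
    then show ?thesis
      using nn_integral_chain_fillings'[OF L] by (simp add: fillings(2) G_def L_def)
  qed
  have "G 1 < \<infinity>"
    using limit(2) ennreal_less_top[of 2] by (simp add: le_less_trans)
  have "0 \<le> star_term p \<alpha> m" "0 \<le> schur_term \<nu> \<gamma> m'" for m m'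
    by (simp_all add: star_term_def schur_term_def prod_nonneg)
  then show ?thesis
    unfolding zeta_star_def schur_zeta_def
    using summable_if_nn_integral_eq[OF _ star \<open>G 1 < \<infinity>\<close>]
      summable_if_nn_integral_eq[OF _ schur \<open>G 1 < \<infinity>\<close>] by simp
qed

end
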